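(* Let $p$ be a positive integer and $q\in(0,1)$. The function $$f(x)=\frac{1}{\left(\frac{[p]_q}{[p+1]_q}\,\Gamma_{p,q}(x+1)\right)^{1/x}}$$ is logarithmically completely monotonic on $(0,\infty)$.
   Context: For $q\in(0,1)$ and real $x$, $[x]_q=\frac{1-q^x}{1-q}$, and for a positive integer $p$, $[p]_q!=[1]_q[2]_q\cdots[p]_q$. For $x>0$, $\Gamma_{p,q}(x)=\frac{[p]_q^{x}\,[p]_q!}{[x]_q[x+1]_q\cdots[x+p]_q}$. A positive function $f$ on an open interval $I$ is logarithmically completely monotonic on $I$ if it has derivatives of all orders on $I$ and $(-1)^n[\ln f(x)]^{(n)}\ge0$ for all $x\in I$ and all $n=1,2,\ldots$. *)

theory Defs
  imports "HOL-Analysis.Analysis"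
begin

definition q_bracket :: "real \<Rightarrow> real \<Rightarrow> real" where
  "q_bracket q x = (1 - q powr x) / (1 - q)"

definition q_fact :: "real \<Rightarrow> nat \<Rightarrow> real" where
  "q_fact q p = (\<Prod>k=1..p. q_bracket q (real k))"

text \<open>Only meaningful for \<open>p \<ge> 1\<close>, \<open>0 < q < 1\<close> and \<open>x > 0\<close>.\<close>

definition pq_Gamma :: "nat \<Rightarrow> real \<Rightarrow> real \<Rightarrow> real" where
  "pq_Gamma p q x =
     q_bracket q (real p) powr x * q_fact q p / (\<Prod>k=0..p. q_bracket q (x + real k))"

text \<open>
  Since \<open>I\<close> is open, \<open>(deriv ^^ n) f\<close> on \<open>I\<close> depends only on the values of \<open>f\<close> on \<open>I\<close>.
  The function \<open>deriv\<close> is total, so existence of all derivatives is required separately.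
  The sign condition starts at \<open>n = 1\<close>: \<open>ln f\<close> itself may be negative.
\<close>

definition log_completely_monotonic_on :: "real set \<Rightarrow> (real \<Rightarrow> real) \<Rightarrow> bool" where
  "log_completely_monotonic_on I f \<longleftrightarrow>
     open I \<and> is_interval I \<and>
     (\<forall>x\<in>I. f x > 0) \<and>
     (\<forall>n. \<forall>x\<in>I. (deriv ^^ n) f differentiable (at x)) \<and>
     (\<forall>n\<ge>1. \<forall>x\<in>I. (-1) ^ n * (deriv ^^ n) (\<lambda>t. ln (f t)) x \<ge> 0)"

end

theory Submission
  imports Defs "HOL-Computational_Algebra.Polynomial"
begin

text \<open>
  Write \<open>f = exp (\<phi>(x) / x)\<close>, where \<open>\<phi>(x) = - ln ([p]/[p+1] \<cdot> \<Gamma>(x + 1))\<close>.  Two facts about \<open>\<phi>\<close>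
  suffice.

  \<^item> Its derivatives of order at least two have the signs \<open>(-1)\<^sup>n \<phi>\<^sup>(\<^sup>n\<^sup>+\<^sup>1\<^sup>) \<ge> 0\<close>, \<open>n \<ge> 1\<close>.  Up to an affine
    function, \<open>\<phi>\<close> is \<open>\<Sum>k\<le>p. ln (1 - q powr (x + 1 + k))\<close>, and the derivatives of
    \<open>- ln (1 - q powr y)\<close> are \<open>(ln q)\<^sup>n\<close> times polynomials with nonnegative coefficients in the
    nonnegative quantity \<open>s = q powr y / (1 - q powr y)\<close>, because \<open>s' = ln q \<cdot> (s + s\<^sup>2)\<close>.  As
    \<open>ln q < 0\<close>, these derivatives alternate in sign (\<open>q_log_deriv_sign\<close>).

  \<^item> \<open>\<phi>(0) = 2 ln ([p+1]/[p]) \<ge> 0\<close>, since \<open>\<Gamma>(1) = [p]/[p+1]\<close>.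

  Both are transported to the quotient \<open>L(x) = \<phi>(x) / x\<close> by the identity
  \<open>(x\<^sup>n\<^sup>+\<^sup>1 L\<^sup>(\<^sup>n\<^sup>)(x))' = x\<^sup>n \<phi>\<^sup>(\<^sup>n\<^sup>+\<^sup>1\<^sup>)(x)\<close>: the function \<open>(-1)\<^sup>n x\<^sup>n\<^sup>+\<^sup>1 L\<^sup>(\<^sup>n\<^sup>)(x)\<close> tends to
  \<open>n! \<phi>(0) \<ge> 0\<close> at the origin and is nondecreasing for \<open>n \<ge> 1\<close>, so it is nonnegative
  (\<open>quot_deriv_sign\<close>).

  Smoothness of \<open>f\<close> itself is inherited from that of \<open>L\<close>: the algebra generated by \<open>exp L\<close> and the
  derivatives of \<open>L\<close> is closed under differentiation.
\<close>

section \<open>Iterated derivatives\<close>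

lemma deriv_funpow_eq:
  fixes F :: "nat \<Rightarrow> real \<Rightarrow> real"
  assumes "open S"
    and F: "\<And>n x. x \<in> S \<Longrightarrow> (F n has_real_derivative F (Suc n) x) (at x)"
    and g: "\<And>x. x \<in> S \<Longrightarrow> g x = F 0 x"
    and "x \<in> S"
  shows "(deriv ^^ n) g x = F n x"
  using \<open>x \<in> S\<close>
proof (induction n arbitrary: x)
  case 0
  then show ?case by (simp add: g)
next
  case (Suc n)
  have "((deriv ^^ n) g has_real_derivative F (Suc n) x) (at x)"
    by (rule has_field_derivative_transform_within_open[OF F[OF Suc.prems] \<open>open S\<close> Suc.prems])
      (simp add: Suc.IH)
  then show ?case by (simp add: DERIV_imp_deriv)
qed

lemma deriv_funpow_differentiable:
  fixes F :: "nat \<Rightarrow> real \<Rightarrow> real"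
  assumes "open S"
    and F: "\<And>n x. x \<in> S \<Longrightarrow> (F n has_real_derivative F (Suc n) x) (at x)"
    and g: "\<And>x. x \<in> S \<Longrightarrow> g x = F 0 x"
    and "x \<in> S"
  shows "(deriv ^^ n) g differentiable (at x)"
proof -
  have "((deriv ^^ n) g has_real_derivative F (Suc n) x) (at x)"
    by (rule has_field_derivative_transform_within_open[OF F[OF \<open>x \<in> S\<close>] \<open>open S\<close> \<open>x \<in> S\<close>])
      (simp add: deriv_funpow_eq[of S F, OF \<open>open S\<close> F g])
  then show ?thesis
    by (simp add: real_differentiable_def) blast
qed

text \<open>
  Here \<open>L n\<close> stands for the \<open>n\<close>-th derivative of \<open>L 0\<close>.  The generators are chosen so that the
  derivative of each is again a polynomial in them: \<open>(exp L)' = exp L \<cdot> L'\<close>.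
\<close>

inductive_set exp_algebra :: "(nat \<Rightarrow> real \<Rightarrow> real) \<Rightarrow> (real \<Rightarrow> real) set"
  for L :: "nat \<Rightarrow> real \<Rightarrow> real" where
  exp_base: "(\<lambda>x. exp (L 0 x)) \<in> exp_algebra L"
| deriv_mem: "L n \<in> exp_algebra L"
| add_mem: "g \<in> exp_algebra L \<Longrightarrow> h \<in> exp_algebra L \<Longrightarrow> (\<lambda>x. g x + h x) \<in> exp_algebra L"
| mult_mem: "g \<in> exp_algebra L \<Longrightarrow> h \<in> exp_algebra L \<Longrightarrow> (\<lambda>x. g x * h x) \<in> exp_algebra L"

lemma exp_algebra_deriv_closed:
  assumes L: "\<And>n x. x \<in> S \<Longrightarrow> (L n has_real_derivative L (Suc n) x) (at x)"
    and "g \<in> exp_algebra L"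
  shows "\<exists>g' \<in> exp_algebra L. \<forall>x\<in>S. (g has_real_derivative g' x) (at x)"
  using assms(2)
proof induction
  case exp_base
  have "(\<lambda>x. exp (L 0 x) * L 1 x) \<in> exp_algebra L"
    by (intro exp_algebra.intros)
  moreover have "\<forall>x\<in>S. ((\<lambda>x. exp (L 0 x)) has_real_derivative exp (L 0 x) * L 1 x) (at x)"
    using L by (auto intro!: derivative_eq_intros)
  ultimately show ?case
    by (intro bexI[of _ "\<lambda>x. exp (L 0 x) * L 1 x"])
next
  case (deriv_mem n)
  show ?case
    using L by (intro bexI[of _ "L (Suc n)"] exp_algebra.intros) auto
next
  case (add_mem g h)
  then obtain g' h' where "g' \<in> exp_algebra L" "h' \<in> exp_algebra L"
    "\<forall>x\<in>S. (g has_real_derivative g' x) (at x)" "\<forall>x\<in>S. (h has_real_derivative h' x) (at x)"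
    by blast
  then show ?case
    by (intro bexI[of _ "\<lambda>x. g' x + h' x"] exp_algebra.intros) (auto intro!: derivative_intros)
next
  case (mult_mem g h)
  then obtain g' h' where "g' \<in> exp_algebra L" "h' \<in> exp_algebra L"
    "\<forall>x\<in>S. (g has_real_derivative g' x) (at x)" "\<forall>x\<in>S. (h has_real_derivative h' x) (at x)"
    by blast
  with mult_mem.hyps show ?case
    by (intro bexI[of _ "\<lambda>x. g' x * h x + h' x * g x"] exp_algebra.intros)
      (auto intro!: DERIV_mult)
qed

text \<open>
  Every member of the algebra has a derivative in the algebra; iterating a choice of such a
  derivative, starting from \<open>exp \<circ> L 0\<close>, yields the whole sequence at once.
\<close>

lemma exp_derivatives_exist:
  assumes L: "\<And>n x. x \<in> S \<Longrightarrow> (L n has_real_derivative L (Suc n) x) (at x)"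
  obtains F :: "nat \<Rightarrow> real \<Rightarrow> real"
  where "F 0 = (\<lambda>x. exp (L 0 x))"
    and "\<And>n x. x \<in> S \<Longrightarrow> (F n has_real_derivative F (Suc n) x) (at x)"
proof -
  obtain D where D: "\<And>g. g \<in> exp_algebra L \<Longrightarrow>
      D g \<in> exp_algebra L \<and> (\<forall>x\<in>S. (g has_real_derivative D g x) (at x))"
    using exp_algebra_deriv_closed[of S L, OF L] by metis
  define F where "F n = (D ^^ n) (\<lambda>x. exp (L 0 x))" for n
  have "F n \<in> exp_algebra L" for n
    by (induction n) (auto simp: F_def D exp_base)
  moreover have "F (Suc n) = D (F n)" for n
    by (simp add: F_def)
  ultimately show thesis
    using that[of F] D by (simp add: F_def)
qed

section \<open>Dividing by the variable\<close>

text \<open>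
  If \<open>\<phi> n\<close> is the \<open>n\<close>-th derivative of \<open>\<phi> 0\<close>, then \<open>quot_num \<phi> n x\<close> is \<open>x\<^sup>n\<^sup>+\<^sup>1\<close> times the
  \<open>n\<close>-th derivative of \<open>\<phi> 0 x / x\<close>.  The recursion is Leibniz' rule for the product of the
  quotient with \<open>x\<close>; written this way the numerator makes sense at the origin as well.
\<close>

primrec quot_num :: "(nat \<Rightarrow> real \<Rightarrow> real) \<Rightarrow> nat \<Rightarrow> real \<Rightarrow> real" where
  "quot_num \<phi> 0 x = \<phi> 0 x"
| "quot_num \<phi> (Suc n) x = x ^ Suc n * \<phi> (Suc n) x - real (Suc n) * quot_num \<phi> n x"

lemma quot_num_at_0: "quot_num \<phi> n 0 = (-1) ^ n * fact n * \<phi> 0 0"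
  by (induction n) (auto simp: algebra_simps)

text \<open>
  In the derivative of the recursion the terms \<open>(n+1) x\<^sup>n \<phi>\<^sup>(\<^sup>n\<^sup>+\<^sup>1\<^sup>)\<close> cancel, so a single derivative
  of \<open>\<phi> 0\<close> remains and determines the monotonicity of the numerator.
\<close>

lemma quot_num_deriv:
  assumes "\<And>n. (\<phi> n has_real_derivative \<phi> (Suc n) x) (at x)"
  shows "(quot_num \<phi> n has_real_derivative x ^ n * \<phi> (Suc n) x) (at x)"
proof (induction n)
  case 0
  have "quot_num \<phi> 0 = \<phi> 0" by auto
  then show ?case using assms[of 0] by simp
next
  case (Suc n)
  have eq: "quot_num \<phi> (Suc n) = (\<lambda>x. x ^ Suc n * \<phi> (Suc n) x - real (Suc n) * quot_num \<phi> n x)"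
    by auto
  show ?case
    unfolding eq
    by (rule derivative_eq_intros refl assms Suc.IH)+ (simp add: algebra_simps)
qed

lemma quot_deriv:
  assumes "\<And>n. (\<phi> n has_real_derivative \<phi> (Suc n) x) (at x)" and "x \<noteq> 0"
  shows "((\<lambda>x. quot_num \<phi> n x / x ^ Suc n) has_real_derivative
           quot_num \<phi> (Suc n) x / x ^ Suc (Suc n)) (at x)"
proof -
  have "((\<lambda>x. x ^ Suc n) has_real_derivative real (Suc n) * x ^ n) (at x)"
    using DERIV_pow[of "Suc n" x] by simp
  from DERIV_divide[OF quot_num_deriv[of \<phi> x n, OF assms(1)] this]
  have "((\<lambda>x. quot_num \<phi> n x / x ^ Suc n) has_real_derivative
      (x ^ n * \<phi> (Suc n) x * x ^ Suc n - quot_num \<phi> n x * (real (Suc n) * x ^ n))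
        / (x ^ Suc n * x ^ Suc n)) (at x)"
    using \<open>x \<noteq> 0\<close> by simp
  also have "(x ^ n * \<phi> (Suc n) x * x ^ Suc n - quot_num \<phi> n x * (real (Suc n) * x ^ n))
        / (x ^ Suc n * x ^ Suc n) = quot_num \<phi> (Suc n) x / x ^ Suc (Suc n)"
    using \<open>x \<noteq> 0\<close> by (simp add: divide_simps) (simp add: algebra_simps)
  finally show ?thesis .
qed

text \<open>
  By \<open>quot_num_deriv\<close> the sign hypothesis makes \<open>(-1)\<^sup>n\<close> times the numerator nondecreasing, and
  at the origin it equals \<open>n! \<phi>(0)\<close>.  This is why a positive value \<open>\<phi>(0)\<close>, which makes the
  quotient singular at the origin, only helps.
\<close>

lemma quot_deriv_sign:
  assumes \<phi>: "\<And>n x. 0 \<le> x \<Longrightarrow> (\<phi> n has_real_derivative \<phi> (Suc n) x) (at x)"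
    and sign: "\<And>x. 0 \<le> x \<Longrightarrow> 0 \<le> (-1) ^ n * \<phi> (Suc n) x"
    and "0 \<le> \<phi> 0 0" and "0 \<le> x"
  shows "0 \<le> (-1) ^ n * (quot_num \<phi> n x / x ^ Suc n)"
proof -
  have "(-1) ^ n * quot_num \<phi> n 0 \<le> (-1) ^ n * quot_num \<phi> n x"
  proof (rule DERIV_nonneg_imp_nondecreasing[OF \<open>0 \<le> x\<close>])
    fix y :: real assume y: "0 \<le> y" "y \<le> x"
    have "((\<lambda>x. (-1) ^ n * quot_num \<phi> n x) has_real_derivative
        (-1) ^ n * (y ^ n * \<phi> (Suc n) y)) (at y)"
      by (intro DERIV_cmult quot_num_deriv \<phi> y)
    moreover have "0 \<le> (-1) ^ n * (y ^ n * \<phi> (Suc n) y)"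
      using mult_nonneg_nonneg[OF zero_le_power[OF y(1)] sign[OF y(1)]]
      by (simp add: mult.left_commute)
    ultimately show "\<exists>d. ((\<lambda>x. (-1) ^ n * quot_num \<phi> n x) has_real_derivative d) (at y) \<and> 0 \<le> d"
      by blast
  qed
  moreover have "(-1) ^ n * quot_num \<phi> n 0 = fact n * \<phi> 0 0"
    by (simp add: quot_num_at_0 mult.assoc[symmetric] power_mult_distrib[symmetric])
  ultimately have "0 \<le> (-1) ^ n * quot_num \<phi> n x"
    using \<open>0 \<le> \<phi> 0 0\<close> by (metis fact_ge_zero mult_nonneg_nonneg order_trans)
  then show ?thesis
    using \<open>0 \<le> x\<close> by (simp only: times_divide_eq_right divide_nonneg_nonneg zero_le_power)
qed

section \<open>Derivatives of the logarithm of a q-number\<close>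

lemma q_bracket_pos:
  assumes "0 < q" "q < 1" "0 < y"
  shows "0 < q_bracket q y"
  using assms powr_less_mono'[of q 0 y] by (simp add: q_bracket_def)

primrec q_log_poly :: "nat \<Rightarrow> real poly" where
  "q_log_poly 0 = [:0, 1:]"
| "q_log_poly (Suc n) = pderiv (q_log_poly n) * [:0, 1, 1:]"

lemma q_log_poly_coeff_nonneg: "0 \<le> coeff (q_log_poly n) i"
proof (induction n arbitrary: i)
  case 0
  then show ?case by (simp add: coeff_pCons split: nat.split)
next
  case (Suc n)
  then show ?case
    by (auto simp: coeff_mult coeff_pderiv coeff_pCons intro!: sum_nonneg mult_nonneg_nonneg
        split: nat.split)
qed

lemma q_log_poly_nonneg: "0 \<le> s \<Longrightarrow> 0 \<le> poly (q_log_poly n) s"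
  by (auto simp: poly_altdef intro!: sum_nonneg mult_nonneg_nonneg q_log_poly_coeff_nonneg)

definition q_ratio :: "real \<Rightarrow> real \<Rightarrow> real" where
  "q_ratio q y = q powr y / (1 - q powr y)"

text \<open>
  The derivatives of \<open>- ln [y]\<close> for \<open>y > 0\<close>.  With \<open>s\<close> the ratio \<open>q powr y / (1 - q powr y)\<close>, the
  first one is \<open>ln q \<cdot> s\<close>, and the further polynomials come from
  \<open>(P(s))' = P'(s) s' = ln q \<cdot> P'(s) (s + s\<^sup>2)\<close>.
\<close>

primrec q_log_deriv :: "real \<Rightarrow> nat \<Rightarrow> real \<Rightarrow> real" where
  "q_log_deriv q 0 y = - ln (q_bracket q y)"
| "q_log_deriv q (Suc n) y = ln q ^ Suc n * poly (q_log_poly n) (q_ratio q y)"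

lemma q_ratio_deriv:
  assumes "0 < q" "q < 1" "0 < y"
  shows "(q_ratio q has_real_derivative ln q * (q_ratio q y + (q_ratio q y)\<^sup>2)) (at y)"
proof -
  have lt: "q powr y < 1" using assms powr_less_mono'[of q 0 y] by simp
  have "((\<lambda>y. q powr y / (1 - q powr y)) has_real_derivative
      ln q * (q_ratio q y + (q_ratio q y)\<^sup>2)) (at y)"
    using assms lt
    by (auto intro!: derivative_eq_intros simp: q_ratio_def divide_simps power2_eq_square)
      (auto simp: algebra_simps)
  then show ?thesis by (simp add: q_ratio_def[abs_def])
qed

lemma q_log_deriv_deriv:
  assumes "0 < q" "q < 1" "0 < y"
  shows "(q_log_deriv q n has_real_derivative q_log_deriv q (Suc n) y) (at y)"
proof (cases n)
  case 0
  have lt: "q powr y < 1" using assms powr_less_mono'[of q 0 y] by simp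
  have "((\<lambda>y. - ln ((1 - q powr y) / (1 - q))) has_real_derivative ln q * q_ratio q y) (at y)"
    using assms lt
    by (auto intro!: derivative_eq_intros simp: q_ratio_def divide_simps)
  moreover have "q_log_deriv q 0 = (\<lambda>y. - ln ((1 - q powr y) / (1 - q)))"
    by (auto simp: q_bracket_def)
  ultimately show ?thesis using 0 by simp
next
  case (Suc m)
  have eq: "q_log_deriv q (Suc m) = (\<lambda>y. ln q ^ Suc m * poly (q_log_poly m) (q_ratio q y))"
    by auto
  have "((\<lambda>y. poly (q_log_poly m) (q_ratio q y)) has_real_derivative
      poly (pderiv (q_log_poly m)) (q_ratio q y) * (ln q * (q_ratio q y + (q_ratio q y)\<^sup>2))) (at y)"
    by (rule DERIV_chain2[OF poly_DERIV q_ratio_deriv[OF assms]])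
  from DERIV_cmult[OF this, of "ln q ^ Suc m"] show ?thesis
    unfolding Suc eq by (simp add: algebra_simps power2_eq_square)
qed

lemma q_log_deriv_sign:
  assumes "0 < q" "q < 1" "0 < y"
  shows "0 \<le> (-1) ^ Suc n * q_log_deriv q (Suc n) y"
proof -
  have "0 \<le> q_ratio q y"
    using assms powr_less_mono'[of q 0 y] by (simp add: q_ratio_def)
  then have "0 \<le> (- ln q) ^ Suc n * poly (q_log_poly n) (q_ratio q y)"
    using assms by (intro mult_nonneg_nonneg zero_le_power q_log_poly_nonneg) auto
  moreover have "(- ln q) ^ Suc n = (-1) ^ Suc n * ln q ^ Suc n"
    by (rule power_minus)
  ultimately show ?thesis by (simp only: q_log_deriv.simps mult.assoc)
qed

section \<open>The logarithm of the (p,q)-Gamma function\<close>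

text \<open>
  The derivatives of \<open>- ln (c \<cdot> \<Gamma>(x + 1))\<close> on the nonnegative half-line.  The factor \<open>[p]\<^sup>x\<^sup>+\<^sup>1\<close> contributes an affine function,
  which is visible only in the orders 0 and 1.
\<close>

definition neg_ln_Gamma_deriv :: "nat \<Rightarrow> real \<Rightarrow> real \<Rightarrow> nat \<Rightarrow> real \<Rightarrow> real" where
  "neg_ln_Gamma_deriv p q c n x =
     (if n = 0 then - ln c - ln (q_fact q p) - (x + 1) * ln (q_bracket q (real p))
      else if n = 1 then - ln (q_bracket q (real p)) else 0)
     - (\<Sum>k=0..p. q_log_deriv q n (x + 1 + real k))"

lemma q_fact_pos: "0 < q \<Longrightarrow> q < 1 \<Longrightarrow> 0 < q_fact q p"
  unfolding q_fact_def by (intro prod_pos ballI q_bracket_pos) auto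

lemma pq_Gamma_pos:
  assumes "p \<ge> 1" "0 < q" "q < 1" "0 < x"
  shows "0 < pq_Gamma p q x"
proof -
  have "0 < q_bracket q (real p)" "0 < (\<Prod>k=0..p. q_bracket q (x + real k))"
    using assms by (auto intro!: prod_pos q_bracket_pos)
  then show ?thesis
    using q_fact_pos[of q p] assms by (simp add: pq_Gamma_def)
qed

lemma neg_ln_Gamma_deriv_0:
  assumes "p \<ge> 1" "0 < q" "q < 1" "0 < c" "0 \<le> x"
  shows "neg_ln_Gamma_deriv p q c 0 x = - ln (c * pq_Gamma p q (x + 1))"
proof -
  have b: "0 < q_bracket q (real p)" and B: "\<And>k. 0 < q_bracket q (x + 1 + real k)"
    using assms by (auto intro!: q_bracket_pos)
  have B0: "\<And>k. q_bracket q (x + 1 + real k) \<noteq> 0"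
    using B by (metis less_irrefl)
  have P: "0 < (\<Prod>k=0..p. q_bracket q (x + 1 + real k))"
    using B by (intro prod_pos) auto
  have "ln (\<Prod>k=0..p. q_bracket q (x + 1 + real k)) = (\<Sum>k=0..p. ln (q_bracket q (x + 1 + real k)))"
    using B0 B by (intro ln_prod) auto
  then show ?thesis
    using b B0 P q_fact_pos[of q p] assms
    by (simp add: neg_ln_Gamma_deriv_def pq_Gamma_def ln_mult ln_div sum_negf ln_powr)
qed

lemma neg_ln_Gamma_deriv_deriv:
  assumes "0 < q" "q < 1" "0 \<le> x"
  shows "(neg_ln_Gamma_deriv p q c n has_real_derivative neg_ln_Gamma_deriv p q c (Suc n) x) (at x)"
proof -
  have D: "((\<lambda>x. q_log_deriv q n (x + 1 + real k)) has_real_derivative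
      q_log_deriv q (Suc n) (x + 1 + real k)) (at x)" for k
  proof -
    have "((\<lambda>x. x + 1 + real k) has_real_derivative 1) (at x)"
      by (auto intro!: derivative_eq_intros)
    moreover have "(q_log_deriv q n has_real_derivative q_log_deriv q (Suc n) (x + 1 + real k))
        (at (x + 1 + real k))"
      using assms by (intro q_log_deriv_deriv) auto
    ultimately show ?thesis
      using DERIV_chain2[where f = "q_log_deriv q n" and g = "\<lambda>x. x + 1 + real k" and Db = 1]
      by fastforce
  qed
  have A: "((\<lambda>x. if n = 0 then - ln c - ln (q_fact q p) - (x + 1) * ln (q_bracket q (real p))
       else if n = 1 then - ln (q_bracket q (real p)) else 0) has_real_derivative
      (if Suc n = 0 then - ln c - ln (q_fact q p) - (x + 1) * ln (q_bracket q (real p))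
       else if Suc n = 1 then - ln (q_bracket q (real p)) else 0)) (at x)"
    by (cases "n = 0") (auto intro!: derivative_eq_intros)
  show ?thesis
    unfolding neg_ln_Gamma_deriv_def[abs_def] by (intro DERIV_diff DERIV_sum D A)
qed

lemma neg_ln_Gamma_deriv_sign:
  assumes "0 < q" "q < 1" "0 \<le> x" "n \<ge> 1"
  shows "0 \<le> (-1) ^ n * neg_ln_Gamma_deriv p q c (Suc n) x"
proof -
  have "0 \<le> (\<Sum>k=0..p. (-1) ^ Suc n * q_log_deriv q (Suc n) (x + 1 + real k))"
    using assms by (intro sum_nonneg q_log_deriv_sign) auto
  also have "\<dots> = (-1) ^ n * neg_ln_Gamma_deriv p q c (Suc n) x"
    using assms(4) by (simp add: neg_ln_Gamma_deriv_def sum_distrib_left sum_negf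
        del: q_log_deriv.simps)
  finally show ?thesis .
qed

lemma pq_Gamma_1:
  assumes "p \<ge> 1" "0 < q" "q < 1"
  shows "pq_Gamma p q 1 = q_bracket q (real p) / q_bracket q (real (p + 1))"
proof -
  have "(\<Prod>k=0..p. q_bracket q (1 + real k)) = q_fact q (p + 1)"
    unfolding q_fact_def by (rule prod.reindex_bij_witness[of _ "\<lambda>k. k - 1" Suc]) auto
  also have "\<dots> = q_fact q p * q_bracket q (real (p + 1))"
    by (simp add: q_fact_def)
  finally show ?thesis
    using q_fact_pos[of q p] q_bracket_pos[of q "real p"] assms by (simp add: pq_Gamma_def)
qed

theorem theorem3p2:
  fixes p :: nat and q :: real
  assumes "p \<ge> 1" and "0 < q" and "q < 1"
  shows "log_completely_monotonic_on {0<..}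
    (\<lambda>x. 1 / ((q_bracket q (real p) / q_bracket q (real (p + 1)) * pq_Gamma p q (x + 1)) powr (1 / x)))"
proof -
  define c where "c = q_bracket q (real p) / q_bracket q (real (p + 1))"
  define f where "f x = 1 / ((c * pq_Gamma p q (x + 1)) powr (1 / x))" for x
  define \<phi> where "\<phi> = neg_ln_Gamma_deriv p q c"
  define L where "L n x = quot_num \<phi> n x / x ^ Suc n" for n x
  have b: "0 < q_bracket q (real p)" "0 < q_bracket q (real (p + 1))"
    using assms by (auto intro!: q_bracket_pos)
  have c: "0 < c" using b by (simp add: c_def)
  have "q powr real (p + 1) \<le> q powr real p"
    using assms by (intro powr_mono') auto
  then have c1: "c \<le> 1"
    using b assms by (simp add: c_def q_bracket_def divide_simps)
  have \<phi>': "(\<phi> n has_real_derivative \<phi> (Suc n) x) (at x)" if "0 \<le> x" for n x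
    unfolding \<phi>_def using assms that by (intro neg_ln_Gamma_deriv_deriv)
  have L': "(L n has_real_derivative L (Suc n) x) (at x)" if "x \<in> {0<..}" for n x
    unfolding L_def[abs_def] using that by (intro quot_deriv \<phi>') auto
  \<comment> \<open>At the origin the argument of the logarithm is \<open>c\<^sup>2 \<le> 1\<close>.\<close>
  have "pq_Gamma p q 1 = c"
    unfolding c_def using assms by (rule pq_Gamma_1)
  then have \<phi>0: "0 \<le> \<phi> 0 0"
    using neg_ln_Gamma_deriv_0[of p q c 0] assms c c1 by (simp add: \<phi>_def ln_mult)
  have pos: "0 < c * pq_Gamma p q (x + 1)" if "x \<in> {0<..}" for x
    using that assms c by (intro mult_pos_pos pq_Gamma_pos) auto
  have lnf: "ln (f x) = L 0 x" if "x \<in> {0<..}" for x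
  proof -
    have "ln (f x) = - ln (c * pq_Gamma p q (x + 1)) / x"
      using pos[OF that] that unfolding f_def
      by (auto simp: ln_div ln_powr)
    then show ?thesis
      using neg_ln_Gamma_deriv_0[of p q c x] assms c that by (simp add: L_def \<phi>_def)
  qed
  have fpos: "0 < f x" if "x \<in> {0<..}" for x
    using pos[OF that] by (metis f_def less_irrefl powr_gt_zero zero_less_divide_1_iff)
  have f_exp: "f x = exp (L 0 x)" if "x \<in> {0<..}" for x
    using fpos[OF that] lnf[OF that] by (metis exp_ln)
  obtain F where F: "F 0 = (\<lambda>x. exp (L 0 x))"
    and F': "\<And>n x. x \<in> {0<..} \<Longrightarrow> (F n has_real_derivative F (Suc n) x) (at x)"
    using exp_derivatives_exist[of "{0<..}" L] L' by blast
  have "(deriv ^^ n) f differentiable (at x)" if "x \<in> {0<..}" for n x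
    using deriv_funpow_differentiable[of "{0<..}" F f x n] F F' f_exp that by simp
  moreover have "0 \<le> (-1) ^ n * (deriv ^^ n) (\<lambda>t. ln (f t)) x"
    if "n \<ge> 1" "x \<in> {0<..}" for n x
  proof -
    have "(deriv ^^ n) (\<lambda>t. ln (f t)) x = L n x"
      using deriv_funpow_eq[of "{0<..}" L "\<lambda>t. ln (f t)" x n] L' lnf that by simp
    moreover have "0 \<le> (-1) ^ n * L n x"
      unfolding L_def
    proof (rule quot_deriv_sign)
      show "0 \<le> (-1) ^ n * \<phi> (Suc n) y" if "0 \<le> y" for y
        unfolding \<phi>_def using assms that \<open>n \<ge> 1\<close> by (intro neg_ln_Gamma_deriv_sign)
    qed (use \<phi>' \<phi>0 that in auto)
    ultimately show ?thesis by simp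
  qed
  ultimately have "log_completely_monotonic_on {0<..} f"
    unfolding log_completely_monotonic_on_def using fpos by (auto simp: is_interval_oi)
  then show ?thesis
    unfolding f_def[abs_def] c_def .
qed

end
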